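(* Let $P\subseteq\mathbb{T}^\omega$ be a property. (1) $P$ is a safety property iff $P$ only has finite counterexamples. (2) $P$ is a liveness property iff $P$ has no finite counterexamples.
   Context: Fix a finite non-empty set $\mathit{AP}$ of atomic propositions. A probabilistic tree (PT) is a tuple $T=(W,L,P)$ where $\epsilon\notin W$, $W\cup\{\epsilon\}\subseteq\mathbb{N}^*$ is prefix-closed, $L:W\to\mathcal{P}(\mathit{AP})$, and $P$ is a partial function from $W$ to distributions over $W$ such that $P(\pi)(\pi')>0$ iff $\pi'=\pi\cdot n\in W$ for some $n\in\mathbb{N}$. $T$ is total if for every $\pi_1\in W$ there is $\pi_2\in W$ having $\pi_1$ as a proper prefix; $T$ is finite-depth if there is $n$ with $|\pi|\le n$ for all $\pi\in W$. $\mathbb{T}^\omega$, $\mathbb{T}^*$: sets of total and finite-depth PTs. For $T_1=(W_1,L_1,P_1)\in\mathbb{T}^*$ and a PT $T_2=(W_2,L_2,P_2)$, $T_1\preceq T_2$ iff $W_1\subseteq W_2$, $L_2$ restricted to $W_1$ equals $L_1$, and $P_2$ restricted to $W_1\times W_1$ equals $P_1$. $\mathit{Pre}_{\mathit{fin}}(T)=\{T_1\in\mathbb{T}^*\mid T_1\preceq T\}$. A property is a subset of $\mathbb{T}^\omega$; safety: for all $T\in\mathbb{T}^\omega$, $T\in P$ iff every $T_1\in\mathit{Pre}_{\mathit{fin}}(T)$ has some $T_2\in P$ with $T_1\preceq T_2$; liveness: every $T_1\in\mathbb{T}^*$ has some $T_2\in P$ with $T_1\preceq T_2$. A Markov chain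 (MC) is $\mathsf{D}=(S,\mathit{AP},\to,L,s_0)$ with $S\subseteq\mathbb{N}$ countable, $\to:S\to\mathit{Dist}(S)$ a (total) transition function, $L:S\to\mathcal{P}(\mathit{AP})$, $s_0\in S$. Its unfolding $T(\mathsf{D})=(W_\mathsf{D},L_\mathsf{D},P_\mathsf{D})$: $W_\mathsf{D}$ is the least set of sequences containing $s_0$ and containing $\pi\cdot t$ whenever $\pi\in W_\mathsf{D}$, $\mathrm{last}(\pi)\to\mu$ and $\mu(t)>0$; $L_\mathsf{D}(\pi)=L(\mathrm{last}(\pi))$; $P_\mathsf{D}(\pi,\pi')=\mu(\mathrm{last}(\pi'))$ where $\mathrm{last}(\pi)\to\mu$. $\mathsf{D}\models P$ iff $T(\mathsf{D})\in P$. $P$ only has finite counterexamples iff for every MC $\mathsf{D}$ with $\mathsf{D}\not\models P$ there is $T_1\in\mathit{Pre}_{\mathit{fin}}(T(\mathsf{D}))$ such that $T_1\not\preceq T_2$ for all $T_2\in P$. $P$ has no finite counterexamples iff for every MC $\mathsf{D}$ with $\mathsf{D}\not\models P$ and every $T_1\in\mathit{Pre}_{\mathit{fin}}(T(\mathsf{D}))$ there is $T_2\in P$ with $T_1\preceq T_2$.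
   Formalization: The formal theorem assumes that P is closed under isomorphism (renaming of tree nodes) and that every PT has exactly one root (one node of length 1, so no empty tree or forest); without these the equivalences fail, since some total PTs are not literally unfoldings of any MC. *)

theory Defs
  imports "HOL-Probability.Probability_Mass_Function" "HOL-Library.Sublist"
begin

text \<open>
  Atomic propositions are the elements of a type \<open>'ap :: finite\<close>. The labelling and the transition
  function of a tree are partial maps that are undefined outside the node set, so that two trees
  are equal as terms iff they are equal as tuples \<open>(W, L, P)\<close>.
\<close>

record 'ap ptree =
  nodes :: "nat list set"
  labelling :: "nat list \<Rightarrow> 'ap set option"
  distrib :: "nat list \<Rightarrow> nat list pmf option"

text \<open>\<open>P\<close> as a function on pairs of nodes; an undefined \<open>P(\<pi>)\<close> gives probability 0.\<close>

definition edge_prob :: "('ap :: finite) ptree \<Rightarrow> nat list \<Rightarrow> nat list \<Rightarrow> real" where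
  "edge_prob T \<pi> \<pi>' = (case distrib T \<pi> of None \<Rightarrow> 0 | Some \<mu> \<Rightarrow> pmf \<mu> \<pi>')"

text \<open>
  Being a tree, \<open>W \<union> {\<epsilon>}\<close> carries exactly one root, i.e. one node of length 1; neither the empty
  node set nor a forest with several nodes of length 1 is admitted.
\<close>

definition is_ptree :: "('ap :: finite) ptree \<Rightarrow> bool" where
  "is_ptree T \<longleftrightarrow>
     [] \<notin> nodes T \<and>
     (\<forall>\<pi> \<in> nodes T \<union> {[]}. \<forall>\<pi>'. prefix \<pi>' \<pi> \<longrightarrow> \<pi>' \<in> nodes T \<union> {[]}) \<and>
     (\<exists>!n. [n] \<in> nodes T) \<and>
     dom (labelling T) = nodes T \<and>
     dom (distrib T) \<subseteq> nodes T \<and>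
     (\<forall>\<pi> \<mu>. distrib T \<pi> = Some \<mu> \<longrightarrow> set_pmf \<mu> \<subseteq> nodes T) \<and>
     (\<forall>\<pi> \<in> nodes T. \<forall>\<pi>'. edge_prob T \<pi> \<pi>' > 0 \<longleftrightarrow> (\<exists>n. \<pi>' = \<pi> @ [n] \<and> \<pi>' \<in> nodes T))"

definition total_ptrees :: "('ap :: finite) ptree set" where
  "total_ptrees = {T. is_ptree T \<and> (\<forall>\<pi>\<^sub>1 \<in> nodes T. \<exists>\<pi>\<^sub>2 \<in> nodes T. strict_prefix \<pi>\<^sub>1 \<pi>\<^sub>2)}"

definition finite_depth_ptrees :: "('ap :: finite) ptree set" where
  "finite_depth_ptrees = {T. is_ptree T \<and> (\<exists>n. \<forall>\<pi> \<in> nodes T. length \<pi> \<le> n)}"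

definition ptree_prefix :: "('ap :: finite) ptree \<Rightarrow> 'ap ptree \<Rightarrow> bool" (infix \<open>\<preceq>\<close> 50) where
  "T\<^sub>1 \<preceq> T\<^sub>2 \<longleftrightarrow>
     nodes T\<^sub>1 \<subseteq> nodes T\<^sub>2 \<and>
     (\<forall>\<pi> \<in> nodes T\<^sub>1. labelling T\<^sub>2 \<pi> = labelling T\<^sub>1 \<pi>) \<and>
     (\<forall>\<pi> \<in> nodes T\<^sub>1. \<forall>\<pi>' \<in> nodes T\<^sub>1. edge_prob T\<^sub>2 \<pi> \<pi>' = edge_prob T\<^sub>1 \<pi> \<pi>')"

definition Pre_fin :: "('ap :: finite) ptree \<Rightarrow> 'ap ptree set" where
  "Pre_fin T = {T\<^sub>1 \<in> finite_depth_ptrees. T\<^sub>1 \<preceq> T}"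

definition safety :: "('ap :: finite) ptree set \<Rightarrow> bool" where
  "safety P \<longleftrightarrow>
     (\<forall>T \<in> total_ptrees. T \<in> P \<longleftrightarrow> (\<forall>T\<^sub>1 \<in> Pre_fin T. \<exists>T\<^sub>2 \<in> P. T\<^sub>1 \<preceq> T\<^sub>2))"

definition liveness :: "('ap :: finite) ptree set \<Rightarrow> bool" where
  "liveness P \<longleftrightarrow> (\<forall>T\<^sub>1 \<in> finite_depth_ptrees. \<exists>T\<^sub>2 \<in> P. T\<^sub>1 \<preceq> T\<^sub>2)"

text \<open>
  Trees matter only up to a renaming of the nodes: the unfolding of a Markov chain uses state
  names as node names, so a tree in which the same number occurs in two nodes with different
  labels or successors is an unfolding only up to isomorphism.
\<close>

definition ptree_iso :: "('ap :: finite) ptree \<Rightarrow> 'ap ptree \<Rightarrow> bool" where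
  "ptree_iso T T' \<longleftrightarrow>
     (\<exists>f. bij_betw f (nodes T) (nodes T') \<and>
          (\<forall>\<pi> \<in> nodes T. \<forall>\<pi>' \<in> nodes T. prefix (f \<pi>) (f \<pi>') \<longleftrightarrow> prefix \<pi> \<pi>') \<and>
          (\<forall>\<pi> \<in> nodes T. labelling T' (f \<pi>) = labelling T \<pi>) \<and>
          (\<forall>\<pi> \<in> nodes T. \<forall>\<pi>' \<in> nodes T. edge_prob T' (f \<pi>) (f \<pi>') = edge_prob T \<pi> \<pi>'))"

definition iso_closed :: "('ap :: finite) ptree set \<Rightarrow> bool" where
  "iso_closed P \<longleftrightarrow> (\<forall>T \<in> P. \<forall>T'. is_ptree T' \<longrightarrow> ptree_iso T T' \<longrightarrow> T' \<in> P)"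

record 'ap mc =
  states :: "nat set"
  trans_fun :: "nat \<Rightarrow> nat pmf"
  state_label :: "nat \<Rightarrow> 'ap set"
  init :: nat

definition is_mc :: "('ap :: finite) mc \<Rightarrow> bool" where
  "is_mc D \<longleftrightarrow> init D \<in> states D \<and> (\<forall>s \<in> states D. set_pmf (trans_fun D s) \<subseteq> states D)"

inductive_set unfold_nodes :: "('ap :: finite) mc \<Rightarrow> nat list set" for D where
  root: "[init D] \<in> unfold_nodes D"
| step: "\<pi> \<in> unfold_nodes D \<Longrightarrow> pmf (trans_fun D (last \<pi>)) t > 0 \<Longrightarrow> \<pi> @ [t] \<in> unfold_nodes D"

text \<open>\<open>P\<^sub>D(\<pi>, \<pi>') = \<mu>(last \<pi>')\<close> is meant for the children \<open>\<pi>'\<close> of \<open>\<pi>\<close>; elsewhere it is 0.\<close>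

definition mc_unfolding :: "('ap :: finite) mc \<Rightarrow> 'ap ptree" where
  "mc_unfolding D =
     \<lparr>nodes = unfold_nodes D,
      labelling = (\<lambda>\<pi>. if \<pi> \<in> unfold_nodes D then Some (state_label D (last \<pi>)) else None),
      distrib = (\<lambda>\<pi>. if \<pi> \<in> unfold_nodes D
                     then Some (map_pmf (\<lambda>t. \<pi> @ [t]) (trans_fun D (last \<pi>))) else None)\<rparr>"

definition mc_sat :: "('ap :: finite) mc \<Rightarrow> 'ap ptree set \<Rightarrow> bool" where
  "mc_sat D P \<longleftrightarrow> mc_unfolding D \<in> P"

definition only_finite_counterexamples :: "('ap :: finite) ptree set \<Rightarrow> bool" where
  "only_finite_counterexamples P \<longleftrightarrow>
     (\<forall>D. is_mc D \<longrightarrow> \<not> mc_sat D P \<longrightarrow>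
        (\<exists>T\<^sub>1 \<in> Pre_fin (mc_unfolding D). \<forall>T\<^sub>2 \<in> P. \<not> T\<^sub>1 \<preceq> T\<^sub>2))"

definition no_finite_counterexamples :: "('ap :: finite) ptree set \<Rightarrow> bool" where
  "no_finite_counterexamples P \<longleftrightarrow>
     (\<forall>D. is_mc D \<longrightarrow> \<not> mc_sat D P \<longrightarrow>
        (\<forall>T\<^sub>1 \<in> Pre_fin (mc_unfolding D). \<exists>T\<^sub>2 \<in> P. T\<^sub>1 \<preceq> T\<^sub>2))"

lemma edge_prob_unfolding:
  assumes "\<pi> \<in> unfold_nodes D"
  shows "edge_prob (mc_unfolding D) \<pi> (\<pi> @ [t]) = pmf (trans_fun D (last \<pi>)) t"
proof -
  have "inj (\<lambda>t. \<pi> @ [t])" by (auto intro: injI)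
  then show ?thesis using assms pmf_map_inj'[of "\<lambda>t. \<pi> @ [t]"]
    by (simp add: edge_prob_def mc_unfolding_def)
qed

lemma unfold_nodes_Nil: "[] \<notin> unfold_nodes D"
proof
  assume "[] \<in> unfold_nodes D"
  then show False by cases auto
qed

lemma unfold_nodes_singleton: "[n] \<in> unfold_nodes D \<longleftrightarrow> n = init D"
proof
  assume "[n] \<in> unfold_nodes D"
  then show "n = init D" by cases (auto simp: unfold_nodes_Nil)
qed (simp add: unfold_nodes.root)

lemma unfold_nodes_prefix:
  assumes "\<pi> \<in> unfold_nodes D" "prefix \<pi>' \<pi>" "\<pi>' \<noteq> []"
  shows "\<pi>' \<in> unfold_nodes D"
  using assms
  by (induction) (auto simp: prefix_Cons prefix_snoc intro: unfold_nodes.intros)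

lemma unfold_nodes_child:
  assumes "\<pi> \<in> unfold_nodes D"
  shows "\<pi> @ [t] \<in> unfold_nodes D \<longleftrightarrow> pmf (trans_fun D (last \<pi>)) t > 0"
proof
  assume "\<pi> @ [t] \<in> unfold_nodes D"
  then show "pmf (trans_fun D (last \<pi>)) t > 0"
    by cases (use assms unfold_nodes_Nil in auto)
qed (use assms in \<open>rule unfold_nodes.step\<close>)

lemma unfolding_total: "mc_unfolding D \<in> total_ptrees"
proof -
  have edge: "edge_prob (mc_unfolding D) \<pi> \<pi>' > 0 \<longleftrightarrow> (\<exists>n. \<pi>' = \<pi> @ [n] \<and> \<pi>' \<in> unfold_nodes D)"
    if "\<pi> \<in> unfold_nodes D" for \<pi> \<pi>'
  proof (cases "\<exists>n. \<pi>' = \<pi> @ [n]")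
    case True
    then show ?thesis using that by (auto simp: edge_prob_unfolding unfold_nodes_child)
  next
    case False
    then have "\<pi>' \<notin> set_pmf (map_pmf (\<lambda>t. \<pi> @ [t]) (trans_fun D (last \<pi>)))" by auto
    then have "edge_prob (mc_unfolding D) \<pi> \<pi>' = 0"
      using that by (simp add: edge_prob_def mc_unfolding_def pmf_eq_0_set_pmf)
    then show ?thesis using False by auto
  qed
  have tot: "\<exists>\<pi>' \<in> unfold_nodes D. strict_prefix \<pi> \<pi>'" if "\<pi> \<in> unfold_nodes D" for \<pi>
  proof -
    obtain t where "t \<in> set_pmf (trans_fun D (last \<pi>))" using set_pmf_not_empty by fast
    then have "\<pi> @ [t] \<in> unfold_nodes D" using that by (simp add: unfold_nodes_child pmf_positive)
    then show ?thesis by (rule bexI[rotated]) (simp add: strict_prefix_def)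
  qed
  have "is_ptree (mc_unfolding D)"
    unfolding is_ptree_def
    using edge unfold_nodes_Nil[of D] unfold_nodes_prefix[of _ D] unfold_nodes_singleton[of _ D]
    by (auto simp: mc_unfolding_def dom_def set_pmf_iff unfold_nodes_child pmf_positive
             split: if_splits)
  then show ?thesis using tot by (simp add: total_ptrees_def mc_unfolding_def)
qed

end

theory Submission
  imports Defs
begin

text \<open>
  Both nontrivial directions rest on two facts. First, every tree can be renamed (a node is sent to
  the sequence of codes of its nonempty prefixes) so that it becomes a prefix of the unfolding of a
  Markov chain whose states are the codes of nodes, with self-loops at the leaves. Second, if
  \<open>T\<^sub>1 \<preceq> T\<^sub>2\<close>, then every renaming of \<open>T\<^sub>1\<close> extends to one of \<open>T\<^sub>2\<close>, by keeping the suffixes below the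
  leaves of \<open>T\<^sub>1\<close>; no clash can occur, since an inner node of \<open>T\<^sub>1\<close> has the same children in
  \<open>T\<^sub>2\<close>. Extensibility into an isomorphism-closed property is therefore invariant under renaming.
  Total trees are maximal for \<open>\<preceq>\<close>, so for them the first fact gives an isomorphism.
\<close>

section \<open>Elementary facts about trees\<close>

lemma is_ptree_Nil: "is_ptree T \<Longrightarrow> [] \<notin> nodes T"
  by (simp add: is_ptree_def)

lemma is_ptree_prefix:
  assumes "is_ptree T" "\<pi> \<in> nodes T" "prefix \<rho> \<pi>" "\<rho> \<noteq> []"
  shows "\<rho> \<in> nodes T"
proof -
  have "\<forall>\<pi> \<in> nodes T \<union> {[]}. \<forall>\<pi>'. prefix \<pi>' \<pi> \<longrightarrow> \<pi>' \<in> nodes T \<union> {[]}"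
    using assms(1) unfolding is_ptree_def by (elim conjE)
  then show ?thesis using assms(2-4) by blast
qed

lemma is_ptree_root: "is_ptree T \<Longrightarrow> \<exists>!n. [n] \<in> nodes T"
  by (simp add: is_ptree_def)

lemma is_ptree_labelling: "is_ptree T \<Longrightarrow> labelling T \<pi> = None \<longleftrightarrow> \<pi> \<notin> nodes T"
  unfolding is_ptree_def by (metis domIff)

lemma is_ptree_distrib:
  "is_ptree T \<Longrightarrow> distrib T \<pi> = Some \<mu> \<Longrightarrow> \<pi> \<in> nodes T \<and> set_pmf \<mu> \<subseteq> nodes T"
  by (auto simp: is_ptree_def)

lemma is_ptree_edge:
  "is_ptree T \<Longrightarrow> \<pi> \<in> nodes T \<Longrightarrow>
    edge_prob T \<pi> \<pi>' > 0 \<longleftrightarrow> (\<exists>n. \<pi>' = \<pi> @ [n]) \<and> \<pi>' \<in> nodes T"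
  by (simp add: is_ptree_def)

lemma edge_prob_nonneg: "edge_prob T \<pi> \<pi>' \<ge> 0"
  by (simp add: edge_prob_def split: option.split)

lemma edge_prob_eq_0:
  "is_ptree T \<Longrightarrow> \<pi> \<in> nodes T \<Longrightarrow> \<not> ((\<exists>n. \<pi>' = \<pi> @ [n]) \<and> \<pi>' \<in> nodes T) \<Longrightarrow> edge_prob T \<pi> \<pi>' = 0"
  using is_ptree_edge[of T \<pi> \<pi>'] edge_prob_nonneg[of T \<pi> \<pi>'] by (auto simp: less_le)

section \<open>The prefix order on trees\<close>

text \<open>In \<open>T1\<close> the probabilities of the children of an inner node already sum to
  1, and \<open>T2\<close> agrees on them, so no mass is left for a further child. For \<pi> =
  \<open>[]\<close> the uniqueness of the root takes over this role.\<close>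

lemma ptree_prefix_child:
  assumes T1: "is_ptree T1" and T2: "is_ptree T2" and le: "T1 \<preceq> T2"
    and \<pi>: "\<pi> @ [n] \<in> nodes T1" and \<pi>': "\<pi> @ [n'] \<in> nodes T2"
  shows "\<pi> @ [n'] \<in> nodes T1"
proof (cases "\<pi> = []")
  case True
  then show ?thesis
    using is_ptree_root[OF T2] \<pi> \<pi>' le by (auto simp: ptree_prefix_def)
next
  case False
  then have in1: "\<pi> \<in> nodes T1" using is_ptree_prefix[OF T1 \<pi>] by simp
  then have in2: "\<pi> \<in> nodes T2" using le by (auto simp: ptree_prefix_def)
  have "edge_prob T1 \<pi> (\<pi> @ [n]) > 0" using is_ptree_edge[OF T1 in1] \<pi> by auto
  then obtain \<mu>1 where \<mu>1: "distrib T1 \<pi> = Some \<mu>1"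
    by (auto simp: edge_prob_def split: option.splits)
  have "edge_prob T2 \<pi> (\<pi> @ [n']) > 0" using is_ptree_edge[OF T2 in2] \<pi>' by auto
  then obtain \<mu>2 where \<mu>2: "distrib T2 \<pi> = Some \<mu>2" "pmf \<mu>2 (\<pi> @ [n']) > 0"
    by (auto simp: edge_prob_def split: option.splits)
  have sub1: "set_pmf \<mu>1 \<subseteq> nodes T1" using is_ptree_distrib[OF T1 \<mu>1] by simp
  have eq: "pmf \<mu>2 \<rho> = pmf \<mu>1 \<rho>" if "\<rho> \<in> nodes T1" for \<rho>
    using le in1 that \<mu>1 \<mu>2 by (auto simp: ptree_prefix_def edge_prob_def)
  \<comment> \<open>The mass of \<open>\<mu>2\<close> is already exhausted by the nodes of \<open>T1\<close>.\<close>
  have "measure_pmf.prob \<mu>2 (set_pmf \<mu>1) = measure_pmf.prob \<mu>1 (set_pmf \<mu>1)"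
  proof -
    have "measure_pmf.prob \<mu>2 (set_pmf \<mu>1) = infsetsum (pmf \<mu>2) (set_pmf \<mu>1)"
      by (rule measure_pmf_conv_infsetsum)
    also have "\<dots> = infsetsum (pmf \<mu>1) (set_pmf \<mu>1)"
      by (rule infsetsum_cong) (use eq sub1 in auto)
    finally show ?thesis by (simp add: measure_pmf_conv_infsetsum)
  qed
  then have "measure_pmf.prob \<mu>2 (set_pmf \<mu>1) = 1"
    by (simp add: measure_pmf.prob_eq_1 AE_measure_pmf)
  then have "AE \<rho> in measure_pmf \<mu>2. \<rho> \<in> set_pmf \<mu>1"
    by (simp add: measure_pmf.prob_eq_1)
  then have "set_pmf \<mu>2 \<subseteq> set_pmf \<mu>1" by (auto simp: AE_measure_pmf_iff)
  moreover have "\<pi> @ [n'] \<in> set_pmf \<mu>2" using \<mu>2(2) by (simp add: set_pmf_iff)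
  ultimately show ?thesis using sub1 by blast
qed

text \<open>Since \<preceq> compares probabilities only, \<open>distrib\<close> has to be recovered
  from \<open>edge_prob\<close>, which vanishes in both trees on pairs leaving the node set.\<close>

lemma ptree_prefix_antisym_nodes:
  assumes T1: "is_ptree T1" and T2: "is_ptree T2" and le: "T1 \<preceq> T2"
    and nodes: "nodes T1 = nodes T2"
  shows "T1 = T2"
proof -
  have lab: "labelling T1 = labelling T2"
  proof
    fix \<pi> show "labelling T1 \<pi> = labelling T2 \<pi>"
      using le nodes is_ptree_labelling[OF T1, of \<pi>] is_ptree_labelling[OF T2, of \<pi>]
      by (cases "\<pi> \<in> nodes T1") (auto simp: ptree_prefix_def)
  qed
  have edge: "edge_prob T1 \<pi> \<rho> = edge_prob T2 \<pi> \<rho>" if "\<pi> \<in> nodes T1" for \<pi> \<rho>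
    using le nodes that edge_prob_eq_0[OF T1, of \<pi> \<rho>] edge_prob_eq_0[OF T2, of \<pi> \<rho>]
    by (cases "\<rho> \<in> nodes T1") (auto simp: ptree_prefix_def)
  \<comment> \<open>\<open>None\<close> yields the constant 0 and a distribution never does, so
    \<open>edge_prob\<close> tells them apart.\<close>
  have nz: "\<exists>\<rho>. pmf \<mu> \<rho> \<noteq> 0" for \<mu> :: "nat list pmf"
    using set_pmf_not_empty[of \<mu>] by (auto simp: set_pmf_iff)
  have dis: "distrib T1 = distrib T2"
  proof
    fix \<pi> show "distrib T1 \<pi> = distrib T2 \<pi>"
    proof (cases "\<pi> \<in> nodes T1")
      case True
      have "(case distrib T1 \<pi> of None \<Rightarrow> \<lambda>_. 0 | Some \<mu> \<Rightarrow> pmf \<mu>) =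
            (case distrib T2 \<pi> of None \<Rightarrow> \<lambda>_. 0 | Some \<mu> \<Rightarrow> pmf \<mu>)"
        using edge[OF True] by (auto simp: edge_prob_def fun_eq_iff split: option.splits)
      then show ?thesis
        using nz by (auto simp: fun_eq_iff intro: pmf_eqI split: option.splits)
    next
      case False
      then show ?thesis
        using is_ptree_distrib[OF T1, of \<pi>] is_ptree_distrib[OF T2, of \<pi>] nodes
        by (cases "distrib T1 \<pi>"; cases "distrib T2 \<pi>") auto
    qed
  qed
  show ?thesis using nodes lab dis by simp
qed

text \<open>In a total tree every node has a child, so by \<open>ptree_prefix_child\<close> it has
  the same children in \<open>T2\<close>; induction down \<open>T2\<close> then meets no new
  node.\<close>

lemma total_ptree_maximal:
  assumes T1: "T1 \<in> total_ptrees" and T2: "is_ptree T2" and le: "T1 \<preceq> T2"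
  shows "T1 = T2"
proof -
  have tree1: "is_ptree T1" using T1 by (simp add: total_ptrees_def)
  have "\<pi> \<in> nodes T1" if "\<pi> \<in> nodes T2" for \<pi>
    using that
  proof (induction \<pi> rule: rev_induct)
    case Nil
    then show ?case using is_ptree_Nil[OF T2] by simp
  next
    case (snoc n \<pi>)
    have "\<exists>m. \<pi> @ [m] \<in> nodes T1"
    proof (cases "\<pi> = []")
      case True
      then show ?thesis using is_ptree_root[OF tree1] by auto
    next
      case False
      then have "\<pi> \<in> nodes T1" using snoc is_ptree_prefix[OF T2 snoc.prems] by simp
      then obtain \<pi>2 where \<pi>2: "\<pi>2 \<in> nodes T1" "strict_prefix \<pi> \<pi>2"
        using T1 by (auto simp: total_ptrees_def)
      \<comment> \<open>Cutting the proper extension of \<pi> after one further entry gives a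
        child.\<close>
      then obtain m \<sigma> where "\<pi>2 = \<pi> @ m # \<sigma>" by (auto elim: strict_prefixE')
      then show ?thesis using is_ptree_prefix[OF tree1 \<pi>2(1), of "\<pi> @ [m]"] by auto
    qed
    then show ?case using ptree_prefix_child[OF tree1 T2 le _ snoc.prems] by blast
  qed
  then show ?thesis
    using le by (intro ptree_prefix_antisym_nodes[OF tree1 T2 le]) (auto simp: ptree_prefix_def)
qed

section \<open>Length-preserving prefix embeddings\<close>

text \<open>Preserving lengths makes the child relation expressible through \<open>prefix\<close>
  and forces the image of the node set of a tree to be prefix-closed.\<close>

definition prefix_embedding :: "(nat list \<Rightarrow> nat list) \<Rightarrow> nat list set \<Rightarrow> bool" where
  "prefix_embedding g W \<longleftrightarrow>
     (\<forall>\<pi> \<in> W. length (g \<pi>) = length \<pi>) \<and>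
     (\<forall>\<pi> \<in> W. \<forall>\<pi>' \<in> W. prefix (g \<pi>) (g \<pi>') \<longleftrightarrow> prefix \<pi> \<pi>')"

lemma prefix_embedding_length: "prefix_embedding g W \<Longrightarrow> \<pi> \<in> W \<Longrightarrow> length (g \<pi>) = length \<pi>"
  by (simp add: prefix_embedding_def)

lemma prefix_embedding_iff:
  "prefix_embedding g W \<Longrightarrow> \<pi> \<in> W \<Longrightarrow> \<pi>' \<in> W \<Longrightarrow> prefix (g \<pi>) (g \<pi>') \<longleftrightarrow> prefix \<pi> \<pi>'"
  by (simp add: prefix_embedding_def)

lemma prefix_embedding_subset: "prefix_embedding g W \<Longrightarrow> V \<subseteq> W \<Longrightarrow> prefix_embedding g V"
  unfolding prefix_embedding_def by blast

lemma prefix_embedding_inj: "prefix_embedding g W \<Longrightarrow> inj_on g W"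
  unfolding prefix_embedding_def inj_on_def by (metis prefix_order.order_antisym prefix_order.order_refl)

lemma child_iff_prefix: "(\<exists>n. \<pi>' = \<pi> @ [n]) \<longleftrightarrow> prefix \<pi> \<pi>' \<and> length \<pi>' = Suc (length \<pi>)"
  by (auto simp: prefix_def length_Suc_conv[of _ 0])

lemma prefix_embedding_child:
  "prefix_embedding g W \<Longrightarrow> \<pi> \<in> W \<Longrightarrow> \<pi>' \<in> W \<Longrightarrow> (\<exists>n. g \<pi>' = g \<pi> @ [n]) \<longleftrightarrow> (\<exists>n. \<pi>' = \<pi> @ [n])"
  by (simp add: child_iff_prefix prefix_embedding_length prefix_embedding_iff)

lemma prefix_embedding_inv:
  "prefix_embedding g W \<Longrightarrow> prefix_embedding (inv_into W g) (g ` W)"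
  using prefix_embedding_inj[of g W] by (simp add: prefix_embedding_def)

text \<open>A local criterion: injectivity follows by peeling off last entries, since equal images
  have equal images of parents, and then siblings are all that must be separated.\<close>

lemma prefix_embeddingI:
  assumes T: "is_ptree T" and Nil: "h [] = []"
    and step: "\<And>\<pi> n. \<pi> @ [n] \<in> nodes T \<Longrightarrow> \<exists>m. h (\<pi> @ [n]) = h \<pi> @ [m]"
    and sibling: "\<And>\<pi> n n'. \<pi> @ [n] \<in> nodes T \<Longrightarrow> \<pi> @ [n'] \<in> nodes T \<Longrightarrow>
                    h (\<pi> @ [n]) = h (\<pi> @ [n']) \<Longrightarrow> n = n'"
  shows "prefix_embedding h (nodes T)"
proof -
  \<comment> \<open>Adding \<open>[]\<close> lets the inductions treat the root as the child of the
    empty sequence.\<close>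
  define W where "W = insert [] (nodes T)"
  have W: "\<pi> \<in> W" if "\<pi> @ \<sigma> \<in> W" for \<pi> \<sigma>
    using that is_ptree_prefix[OF T, of "\<pi> @ \<sigma>" \<pi>] by (auto simp: W_def)
  have step: "\<exists>m. h (\<pi> @ [n]) = h \<pi> @ [m]" if "\<pi> @ [n] \<in> W" for \<pi> n
    using that step by (auto simp: W_def)
  have len: "length (h \<pi>) = length \<pi>" if "\<pi> \<in> W" for \<pi>
    using that
  proof (induction \<pi> rule: rev_induct)
    case (snoc n \<pi>)
    then show ?case using step[of \<pi> n] W[of \<pi> "[n]"] by auto
  qed (simp add: Nil)
  have mono: "prefix (h \<pi>) (h (\<pi> @ \<sigma>))" if "\<pi> @ \<sigma> \<in> W" for \<pi> \<sigma>
    using that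
  proof (induction \<sigma> rule: rev_induct)
    case (snoc n \<sigma>)
    then have "prefix (h \<pi>) (h (\<pi> @ \<sigma>))" using W[of "\<pi> @ \<sigma>" "[n]"] by simp
    moreover have "prefix (h (\<pi> @ \<sigma>)) (h (\<pi> @ \<sigma> @ [n]))" using step[of "\<pi> @ \<sigma>" n] snoc by auto
    ultimately show ?case by (rule prefix_order.order_trans)
  qed simp
  have inj: "\<pi> = \<pi>'" if "\<pi> \<in> W" "\<pi>' \<in> W" "h \<pi> = h \<pi>'" for \<pi> \<pi>'
    using that
  proof (induction \<pi> arbitrary: \<pi>' rule: rev_induct)
    case Nil
    then have "length \<pi>' = length ([] :: nat list)" using len by metis
    then show ?case by simp
  next
    case (snoc n \<pi>)
    then have "length \<pi>' = length (\<pi> @ [n])" using len by metis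
    then obtain \<rho> n' where \<pi>': "\<pi>' = \<rho> @ [n']" by (cases \<pi>' rule: rev_cases) auto
    have "h \<pi> = h \<rho>" using step[of \<pi> n] step[of \<rho> n'] snoc.prems \<pi>' by auto
    then have "\<pi> = \<rho>" using snoc.IH[of \<rho>] snoc.prems W[of \<pi> "[n]"] W[of \<rho> "[n']"] \<pi>' by simp
    then show ?case using sibling[of \<pi> n n'] snoc.prems \<pi>' by (auto simp: W_def)
  qed
  have "prefix \<pi> \<pi>'" if "\<pi> \<in> W" "\<pi>' \<in> W" "prefix (h \<pi>) (h \<pi>')" for \<pi> \<pi>'
  proof -
    \<comment> \<open>Both \<open>h ?\<rho>\<close> and \<open>h \<pi>\<close> are prefixes of
      \<open>h \<pi>'\<close> of the same length, hence equal, and injectivity identifies \<pi> with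
      a prefix of \<open>\<pi>'\<close>.\<close>
    let ?\<rho> = "take (length \<pi>) \<pi>'"
    have \<rho>: "?\<rho> \<in> W" using W[of ?\<rho> "drop (length \<pi>) \<pi>'"] that by simp
    have "length \<pi> \<le> length \<pi>'" using prefix_length_le[OF that(3)] len that by simp
    then have "length (h ?\<rho>) = length (h \<pi>)" using len \<rho> that by simp
    moreover have "prefix (h ?\<rho>) (h \<pi>')" using mono[of ?\<rho> "drop (length \<pi>) \<pi>'"] that by simp
    ultimately have "h ?\<rho> = h \<pi>" using that(3) by (auto simp: prefix_def)
    then have "?\<rho> = \<pi>" using inj \<rho> that by blast
    then show ?thesis using take_is_prefix by metis
  qed
  then show ?thesis
    unfolding prefix_embedding_def using len mono by (auto simp: W_def prefix_def)
qed

section \<open>Renaming the nodes of a tree\<close>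

definition rename_ptree :: "(nat list \<Rightarrow> nat list) \<Rightarrow> ('ap :: finite) ptree \<Rightarrow> 'ap ptree" where
  "rename_ptree g T =
     \<lparr>nodes = g ` nodes T,
      labelling = (\<lambda>\<rho>. if \<rho> \<in> g ` nodes T then labelling T (inv_into (nodes T) g \<rho>) else None),
      distrib = (\<lambda>\<rho>. if \<rho> \<in> g ` nodes T
                     then map_option (map_pmf g) (distrib T (inv_into (nodes T) g \<rho>)) else None)\<rparr>"

lemma nodes_rename_ptree [simp]: "nodes (rename_ptree g T) = g ` nodes T"
  by (simp add: rename_ptree_def)

lemma labelling_rename_ptree:
  "prefix_embedding g (nodes T) \<Longrightarrow> \<pi> \<in> nodes T \<Longrightarrow> labelling (rename_ptree g T) (g \<pi>) = labelling T \<pi>"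
  by (simp add: rename_ptree_def prefix_embedding_inj)

lemma distrib_rename_ptree:
  "prefix_embedding g (nodes T) \<Longrightarrow> \<pi> \<in> nodes T \<Longrightarrow>
    distrib (rename_ptree g T) (g \<pi>) = map_option (map_pmf g) (distrib T \<pi>)"
  by (simp add: rename_ptree_def prefix_embedding_inj)

lemma edge_prob_rename_ptree:
  assumes T: "is_ptree T" and g: "prefix_embedding g (nodes T)"
    and \<pi>: "\<pi> \<in> nodes T" and \<pi>': "\<pi>' \<in> nodes T"
  shows "edge_prob (rename_ptree g T) (g \<pi>) (g \<pi>') = edge_prob T \<pi> \<pi>'"
proof (cases "distrib T \<pi>")
  case None
  then show ?thesis using distrib_rename_ptree[OF g \<pi>] by (simp add: edge_prob_def)
next
  case (Some \<mu>)
  note inj = prefix_embedding_inj[OF g]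
  \<comment> \<open>As \<open>g\<close> is injective on the nodes only, the support must lie there
    for no two of its points to be merged.\<close>
  have sub: "set_pmf \<mu> \<subseteq> nodes T" using is_ptree_distrib[OF T Some] by simp
  have "pmf (map_pmf g \<mu>) (g \<pi>') = pmf \<mu> \<pi>'"
  proof (cases "\<pi>' \<in> set_pmf \<mu>")
    case True
    then show ?thesis using inj_on_subset[OF inj sub] by (rule pmf_map_inj[rotated])
  next
    case False
    then have "g \<pi>' \<notin> g ` set_pmf \<mu>" using inj_on_image_mem_iff[OF inj \<pi>' sub] by simp
    then show ?thesis using False by (metis pmf_eq_0_set_pmf set_map_pmf)
  qed
  then show ?thesis using distrib_rename_ptree[OF g \<pi>] Some by (simp add: edge_prob_def)
qed

lemma is_ptree_rename_ptree:
  assumes T: "is_ptree T" and g: "prefix_embedding g (nodes T)"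
  shows "is_ptree (rename_ptree g T)"
  unfolding is_ptree_def nodes_rename_ptree
proof (intro conjI)
  show "[] \<notin> g ` nodes T"
    using is_ptree_Nil[OF T] prefix_embedding_length[OF g] by fastforce
  show "\<forall>\<rho> \<in> g ` nodes T \<union> {[]}. \<forall>\<rho>'. prefix \<rho>' \<rho> \<longrightarrow> \<rho>' \<in> g ` nodes T \<union> {[]}"
  proof (intro ballI allI impI)
    fix \<rho> \<rho>' assume \<rho>: "\<rho> \<in> g ` nodes T \<union> {[]}" "prefix \<rho>' \<rho>"
    show "\<rho>' \<in> g ` nodes T \<union> {[]}"
    proof (cases "\<rho>' = []")
      case False
      then obtain \<pi> where \<pi>: "\<pi> \<in> nodes T" "\<rho> = g \<pi>" using \<rho> by auto
      have le: "length \<rho>' \<le> length \<pi>"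
        using prefix_length_le[OF \<rho>(2)] prefix_embedding_length[OF g \<pi>(1)] \<pi> by simp
      \<comment> \<open>The preimage of \<open>\<rho>'\<close> is the prefix of \<pi> of the same
        length: its image is a prefix of \<rho> with the length of \<open>\<rho>'\<close>.\<close>
      let ?\<pi> = "take (length \<rho>') \<pi>"
      have "?\<pi> \<noteq> []" using False le by auto
      then have in_T: "?\<pi> \<in> nodes T" using is_ptree_prefix[OF T \<pi>(1) take_is_prefix] by simp
      then have "prefix (g ?\<pi>) \<rho>"
        using prefix_embedding_iff[OF g _ \<pi>(1)] \<pi>(2) take_is_prefix by auto
      moreover have "length (g ?\<pi>) = length \<rho>'"
        using prefix_embedding_length[OF g in_T] le by simp
      ultimately have "g ?\<pi> = \<rho>'" using \<rho>(2) by (auto simp: prefix_def)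
      then show ?thesis using in_T by (metis UnI1 imageI)
    qed simp
  qed
  obtain r where r: "[r] \<in> nodes T" "\<And>n. [n] \<in> nodes T \<Longrightarrow> n = r"
    using is_ptree_root[OF T] by blast
  obtain m where m: "g [r] = [m]"
    using prefix_embedding_length[OF g r(1)] by (auto simp: length_Suc_conv)
  show "\<exists>!n. [n] \<in> g ` nodes T"
  proof (rule ex1I[of _ m])
    show "[m] \<in> g ` nodes T" using m r by (metis imageI)
    fix n assume "[n] \<in> g ` nodes T"
    then obtain \<pi> where \<pi>: "\<pi> \<in> nodes T" "g \<pi> = [n]" by force
    then have "length \<pi> = 1" using prefix_embedding_length[OF g, of \<pi>] by simp
    then obtain k where "\<pi> = [k]" by (auto simp: length_Suc_conv)
    then show "n = m" using r(2) \<pi> m by auto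
  qed
  show "dom (labelling (rename_ptree g T)) = g ` nodes T"
  proof (intro set_eqI)
    fix \<rho>
    show "\<rho> \<in> dom (labelling (rename_ptree g T)) \<longleftrightarrow> \<rho> \<in> g ` nodes T"
      using is_ptree_labelling[OF T, of "inv_into (nodes T) g \<rho>"] inv_into_into[of \<rho> g "nodes T"]
      by (auto simp: rename_ptree_def domIff)
  qed
  show "dom (distrib (rename_ptree g T)) \<subseteq> g ` nodes T"
    by (auto simp: rename_ptree_def dom_def split: if_splits)
  show sub: "\<forall>\<rho> \<mu>. distrib (rename_ptree g T) \<rho> = Some \<mu> \<longrightarrow> set_pmf \<mu> \<subseteq> g ` nodes T"
  proof (intro allI impI)
    fix \<rho> \<mu> assume "distrib (rename_ptree g T) \<rho> = Some \<mu>"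
    then obtain \<nu> where "distrib T (inv_into (nodes T) g \<rho>) = Some \<nu>" "\<mu> = map_pmf g \<nu>"
      by (auto simp: rename_ptree_def split: if_splits)
    then show "set_pmf \<mu> \<subseteq> g ` nodes T" using is_ptree_distrib[OF T] by auto
  qed
  show "\<forall>\<rho> \<in> g ` nodes T. \<forall>\<rho>'. edge_prob (rename_ptree g T) \<rho> \<rho>' > 0 \<longleftrightarrow>
          (\<exists>n. \<rho>' = \<rho> @ [n] \<and> \<rho>' \<in> g ` nodes T)"
  proof (intro ballI allI)
    fix \<rho> \<rho>' assume "\<rho> \<in> g ` nodes T"
    then obtain \<pi> where \<pi>: "\<pi> \<in> nodes T" "\<rho> = g \<pi>" by auto
    show "edge_prob (rename_ptree g T) \<rho> \<rho>' > 0 \<longleftrightarrow> (\<exists>n. \<rho>' = \<rho> @ [n] \<and> \<rho>' \<in> g ` nodes T)"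
    proof (cases "\<rho>' \<in> g ` nodes T")
      case True
      then obtain \<pi>' where \<pi>': "\<pi>' \<in> nodes T" "\<rho>' = g \<pi>'" by auto
      then show ?thesis
        using \<pi> edge_prob_rename_ptree[OF T g \<pi>(1) \<pi>'(1)] is_ptree_edge[OF T \<pi>(1), of \<pi>']
          prefix_embedding_child[OF g \<pi>(1) \<pi>'(1)] by auto
    next
      case False
      then have "\<not> edge_prob (rename_ptree g T) \<rho> \<rho>' > 0"
        using sub by (auto simp: edge_prob_def pmf_positive_iff split: option.splits)
      then show ?thesis using False by auto
    qed
  qed
qed

lemma ptree_iso_rename_ptree:
  assumes "is_ptree T" "prefix_embedding g (nodes T)"
  shows "ptree_iso T (rename_ptree g T)"
  unfolding ptree_iso_def
  by (rule exI[of _ g])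
    (use assms in \<open>auto simp: bij_betw_def prefix_embedding_inj prefix_embedding_iff
       labelling_rename_ptree edge_prob_rename_ptree\<close>)

lemma iso_closed_rename_ptree:
  assumes "iso_closed P" "T \<in> P" "is_ptree T" "prefix_embedding g (nodes T)"
  shows "rename_ptree g T \<in> P"
  using assms is_ptree_rename_ptree ptree_iso_rename_ptree unfolding iso_closed_def by blast

lemma finite_depth_rename_ptree:
  assumes "T \<in> finite_depth_ptrees" "prefix_embedding g (nodes T)"
  shows "rename_ptree g T \<in> finite_depth_ptrees"
  using assms is_ptree_rename_ptree[of T g] prefix_embedding_length[of g "nodes T"]
  by (auto simp: finite_depth_ptrees_def)

text \<open>Two maps are allowed so that this applies to an extension \<open>h\<close> of a renaming
  \<open>g\<close> given on \<open>T1\<close> alone.\<close>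

lemma rename_ptree_mono:
  assumes T1: "is_ptree T1" and T2: "is_ptree T2" and le: "T1 \<preceq> T2"
    and h: "prefix_embedding h (nodes T2)" and eq: "\<And>\<pi>. \<pi> \<in> nodes T1 \<Longrightarrow> h \<pi> = g \<pi>"
  shows "rename_ptree g T1 \<preceq> rename_ptree h T2"
proof -
  have sub: "nodes T1 \<subseteq> nodes T2" using le by (simp add: ptree_prefix_def)
  have g: "prefix_embedding g (nodes T1)"
    using prefix_embedding_subset[OF h sub] eq by (simp add: prefix_embedding_def)
  have lab: "labelling (rename_ptree h T2) (g \<pi>) = labelling T2 \<pi>" if "\<pi> \<in> nodes T1" for \<pi>
    using labelling_rename_ptree[OF h, of \<pi>] eq[OF that] sub that by auto
  have edge: "edge_prob (rename_ptree h T2) (g \<pi>) (g \<pi>') = edge_prob T2 \<pi> \<pi>'"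
    if "\<pi> \<in> nodes T1" "\<pi>' \<in> nodes T1" for \<pi> \<pi>'
    using edge_prob_rename_ptree[OF T2 h, of \<pi> \<pi>'] eq[OF that(1)] eq[OF that(2)] sub that by auto
  have "g ` nodes T1 \<subseteq> h ` nodes T2" using sub eq by force
  then show ?thesis
    using le by (simp add: ptree_prefix_def lab edge labelling_rename_ptree[OF g]
        edge_prob_rename_ptree[OF T1 g])
qed

text \<open>Equality of the tuples comes from \<preceq> together with equal node sets, which spares
  a comparison of the \<open>distrib\<close> fields.\<close>

lemma rename_ptree_inv:
  assumes T: "is_ptree T" and g: "prefix_embedding g (nodes T)"
  shows "rename_ptree (inv_into (nodes T) g) (rename_ptree g T) = T" (is "rename_ptree ?i ?T = T")
proof -
  have T': "is_ptree ?T" using is_ptree_rename_ptree[OF T g] .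
  have i: "prefix_embedding ?i (nodes ?T)" using prefix_embedding_inv[OF g] by simp
  have inv: "?i (g \<pi>) = \<pi>" if "\<pi> \<in> nodes T" for \<pi>
    using inv_into_f_f[OF prefix_embedding_inj[OF g] that] .
  then have nodes: "nodes (rename_ptree ?i ?T) = nodes T" by (force simp: image_image)
  have "labelling (rename_ptree ?i ?T) \<pi> = labelling T \<pi>" if "\<pi> \<in> nodes T" for \<pi>
    using labelling_rename_ptree[OF i, of "g \<pi>"] labelling_rename_ptree[OF g that] inv[OF that] that
    by simp
  moreover have "edge_prob (rename_ptree ?i ?T) \<pi> \<pi>' = edge_prob T \<pi> \<pi>'"
    if "\<pi> \<in> nodes T" "\<pi>' \<in> nodes T" for \<pi> \<pi>'
    using edge_prob_rename_ptree[OF T' i, of "g \<pi>" "g \<pi>'"] edge_prob_rename_ptree[OF T g that]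
      inv[OF that(1)] inv[OF that(2)] that by simp
  ultimately have "T \<preceq> rename_ptree ?i ?T" using nodes by (simp add: ptree_prefix_def)
  then show ?thesis
    using ptree_prefix_antisym_nodes[OF T is_ptree_rename_ptree[OF T' i]] nodes by simp
qed

section \<open>Extending a renaming to a larger tree\<close>

text \<open>The argument is a node read backwards, so that the recursion goes from a node to its parent.\<close>

primrec extend_rev :: "(nat list \<Rightarrow> nat list) \<Rightarrow> nat list set \<Rightarrow> nat list \<Rightarrow> nat list" where
  "extend_rev g W [] = []"
| "extend_rev g W (n # \<rho>) =
     (if rev \<rho> @ [n] \<in> W then g (rev \<rho> @ [n]) else extend_rev g W \<rho> @ [n])"

text \<open>A node outside \<open>T1\<close> goes to the image of its longest prefix in
  \<open>T1\<close>, followed by the remaining entries. The local criterion applies because siblings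
  in \<open>T2\<close> lie both inside or both outside \<open>T1\<close>.\<close>

lemma prefix_embedding_extend:
  assumes T1: "is_ptree T1" and T2: "is_ptree T2" and le: "T1 \<preceq> T2"
    and g: "prefix_embedding g (nodes T1)"
  obtains h where "prefix_embedding h (nodes T2)" "\<And>\<pi>. \<pi> \<in> nodes T1 \<Longrightarrow> h \<pi> = g \<pi>"
proof
  let ?h = "\<lambda>\<pi>. extend_rev g (nodes T1) (rev \<pi>)"
  show eq: "?h \<pi> = g \<pi>" if "\<pi> \<in> nodes T1" for \<pi>
    using that is_ptree_Nil[OF T1] by (cases \<pi> rule: rev_cases) auto
  show "prefix_embedding ?h (nodes T2)"
  proof (rule prefix_embeddingI[OF T2])
    fix \<pi> n
    assume "\<pi> @ [n] \<in> nodes T2"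
    show "\<exists>m. ?h (\<pi> @ [n]) = ?h \<pi> @ [m]"
    proof (cases "\<pi> @ [n] \<in> nodes T1")
      case True
      show ?thesis
      proof (cases "\<pi> = []")
        case Nil: True
        \<comment> \<open>The empty parent is not a node, so only the length of \<open>g [n]\<close>
          is available here.\<close>
        then show ?thesis using True prefix_embedding_length[OF g True]
          by (auto simp: length_Suc_conv)
      next
        case False
        then have "\<pi> \<in> nodes T1" using is_ptree_prefix[OF T1 True] by simp
        then show ?thesis using prefix_embedding_child[OF g _ True] True eq by auto
      qed
    qed simp
  next
    fix \<pi> n n'
    assume *: "\<pi> @ [n] \<in> nodes T2" "\<pi> @ [n'] \<in> nodes T2" "?h (\<pi> @ [n]) = ?h (\<pi> @ [n'])"
    then have iff: "\<pi> @ [n] \<in> nodes T1 \<longleftrightarrow> \<pi> @ [n'] \<in> nodes T1"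
      using ptree_prefix_child[OF T1 T2 le] by blast
    show "n = n'"
    proof (cases "\<pi> @ [n] \<in> nodes T1")
      case True
      then have "g (\<pi> @ [n]) = g (\<pi> @ [n'])" using * iff by simp
      then have "\<pi> @ [n] = \<pi> @ [n']" using inj_onD[OF prefix_embedding_inj[OF g]] True iff by blast
      then show ?thesis by simp
    next
      case False
      then show ?thesis using * iff by simp
    qed
  qed simp
qed

lemma rename_ptree_extend:
  assumes T1: "is_ptree T1" and T2: "is_ptree T2" and le: "T1 \<preceq> T2"
    and g: "prefix_embedding g (nodes T1)"
  obtains h where "prefix_embedding h (nodes T2)" "rename_ptree g T1 \<preceq> rename_ptree h T2"
proof -
  obtain h where h: "prefix_embedding h (nodes T2)" "\<And>\<pi>. \<pi> \<in> nodes T1 \<Longrightarrow> h \<pi> = g \<pi>"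
    using prefix_embedding_extend[OF assms] by blast
  then show ?thesis using that[OF h(1)] rename_ptree_mono[OF T1 T2 le h] by simp
qed

text \<open>Extend the inverse of \<open>g\<close> from the renamed \<open>T1\<close> to
  \<open>T2\<close>.\<close>

lemma rename_ptree_prefixE:
  assumes T1: "is_ptree T1" and T2: "is_ptree T2" and g: "prefix_embedding g (nodes T1)"
    and le: "rename_ptree g T1 \<preceq> T2"
  obtains h where "prefix_embedding h (nodes T2)" "T1 \<preceq> rename_ptree h T2"
proof -
  have "prefix_embedding (inv_into (nodes T1) g) (nodes (rename_ptree g T1))"
    using prefix_embedding_inv[OF g] by simp
  from rename_ptree_extend[OF is_ptree_rename_ptree[OF T1 g] T2 le this] show ?thesis
    using that rename_ptree_inv[OF T1 g] by metis
qed

text \<open>Undoing the renaming on \<open>T2\<close> stays inside \<open>P\<close> by closure under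
  isomorphism.\<close>

lemma rename_ptree_extends_into:
  assumes P: "P \<subseteq> total_ptrees" "iso_closed P"
    and T1: "is_ptree T1" and g: "prefix_embedding g (nodes T1)"
    and T2: "T2 \<in> P" "rename_ptree g T1 \<preceq> T2"
  shows "\<exists>T \<in> P. T1 \<preceq> T"
proof -
  have tree2: "is_ptree T2" using P T2 by (auto simp: total_ptrees_def)
  obtain h where "prefix_embedding h (nodes T2)" "T1 \<preceq> rename_ptree h T2"
    using rename_ptree_prefixE[OF T1 tree2 g T2(2)] .
  then show ?thesis using iso_closed_rename_ptree[OF P(2) T2(1) tree2] by blast
qed

section \<open>The Markov chain of a tree\<close>

text \<open>An unfolding reads labels and transitions off the last state, so each entry must
  identify the whole node reached and not just its last number. \<open>tl\<close> drops the empty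
  prefix.\<close>

definition path_code :: "nat list \<Rightarrow> nat list" where
  "path_code \<pi> = map to_nat (tl (prefixes \<pi>))"

lemma path_code_Nil [simp]: "path_code [] = []"
  by (simp add: path_code_def)

lemma path_code_snoc [simp]: "path_code (\<pi> @ [n]) = path_code \<pi> @ [to_nat (\<pi> @ [n])]"
  by (simp add: path_code_def prefixes_snoc)

lemma last_path_code: "\<pi> \<noteq> [] \<Longrightarrow> last (path_code \<pi>) = to_nat \<pi>"
  by (cases \<pi> rule: rev_cases) auto

lemma prefix_embedding_path_code: "is_ptree T \<Longrightarrow> prefix_embedding path_code (nodes T)"
  by (rule prefix_embeddingI) auto

text \<open>A leaf has no distribution; its self-loop keeps the transition function total, and the
  unfolding continues below it.\<close>

definition mc_of_ptree :: "('ap :: finite) ptree \<Rightarrow> 'ap mc" where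
  "mc_of_ptree T =
     \<lparr>states = UNIV,
      trans_fun = (\<lambda>s. case distrib T (from_nat s) of None \<Rightarrow> return_pmf s | Some \<mu> \<Rightarrow> map_pmf to_nat \<mu>),
      state_label = (\<lambda>s. the (labelling T (from_nat s))),
      init = to_nat [THE n. [n] \<in> nodes T]\<rparr>"

lemma is_mc_mc_of_ptree: "is_mc (mc_of_ptree T)"
  by (simp add: is_mc_def mc_of_ptree_def)

lemma pmf_trans_fun_mc_of_ptree:
  assumes "edge_prob T \<pi> \<pi>' > 0"
  shows "pmf (trans_fun (mc_of_ptree T) (to_nat \<pi>)) (to_nat \<pi>') = edge_prob T \<pi> \<pi>'"
  using assms by (auto simp: mc_of_ptree_def edge_prob_def pmf_map_inj' split: option.splits)

lemma path_code_unfold_nodes: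
  assumes T: "is_ptree T" and "\<pi> \<in> nodes T"
  shows "path_code \<pi> \<in> unfold_nodes (mc_of_ptree T)"
  using assms(2)
proof (induction \<pi> rule: rev_induct)
  case Nil
  then show ?case using is_ptree_Nil[OF T] by simp
next
  case (snoc n \<pi>)
  show ?case
  proof (cases "\<pi> = []")
    case True
    then have "(THE n. [n] \<in> nodes T) = n"
      using snoc.prems is_ptree_root[OF T] by (intro the1_equality) auto
    then have "[to_nat [n]] = [init (mc_of_ptree T)]" by (simp add: mc_of_ptree_def)
    then show ?thesis using True path_code_snoc[of "[]" n] unfold_nodes.root by simp
  next
    case False
    then have \<pi>: "\<pi> \<in> nodes T" using is_ptree_prefix[OF T snoc.prems] by simp
    then have pos: "edge_prob T \<pi> (\<pi> @ [n]) > 0" using is_ptree_edge[OF T] snoc.prems by auto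
    then show ?thesis
      using snoc.IH[OF \<pi>] pmf_trans_fun_mc_of_ptree[OF pos] last_path_code[OF False]
      by (auto intro!: unfold_nodes.step)
  qed
qed

text \<open>The state reached by \<open>path_code \<pi>\<close> decodes to \<pi>, so the chain
  reproduces its label and edges. Below leaves the unfolding goes on, hence \<preceq> and not
  equality.\<close>

lemma rename_path_code_prefix_unfolding:
  assumes T: "is_ptree T"
  shows "rename_ptree path_code T \<preceq> mc_unfolding (mc_of_ptree T)" (is "_ \<preceq> ?U")
proof -
  note g = prefix_embedding_path_code[OF T]
  note mem = path_code_unfold_nodes[OF T]
  have U: "is_ptree ?U" "nodes ?U = unfold_nodes (mc_of_ptree T)"
    using unfolding_total[of "mc_of_ptree T"] by (auto simp: total_ptrees_def mc_unfolding_def)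
  have lab: "labelling ?U (path_code \<pi>) = labelling T \<pi>" if \<pi>: "\<pi> \<in> nodes T" for \<pi>
  proof -
    have "\<pi> \<noteq> []" using is_ptree_Nil[OF T] \<pi> by auto
    moreover have "labelling T \<pi> \<noteq> None" using is_ptree_labelling[OF T] \<pi> by simp
    ultimately show ?thesis using mem[OF \<pi>] last_path_code[of \<pi>]
      by (auto simp: mc_unfolding_def mc_of_ptree_def)
  qed
  have edge: "edge_prob ?U (path_code \<pi>) (path_code \<pi>') = edge_prob T \<pi> \<pi>'"
    if \<pi>: "\<pi> \<in> nodes T" and \<pi>': "\<pi>' \<in> nodes T" for \<pi> \<pi>'
  proof (cases "\<exists>n. \<pi>' = \<pi> @ [n]")
    case True
    then obtain n where n: "\<pi>' = \<pi> @ [n]" by blast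
    have ne: "\<pi> \<noteq> []" using is_ptree_Nil[OF T] \<pi> by auto
    have "edge_prob T \<pi> \<pi>' > 0" using is_ptree_edge[OF T \<pi>] \<pi>' n by auto
    from pmf_trans_fun_mc_of_ptree[OF this] show ?thesis
      using n edge_prob_unfolding[OF mem[OF \<pi>]] last_path_code[OF ne] by simp
  next
    case False
    \<comment> \<open>Path codes reflect the child relation, so both probabilities are 0.\<close>
    then have "\<not> (\<exists>n. path_code \<pi>' = path_code \<pi> @ [n])"
      using prefix_embedding_child[OF g \<pi> \<pi>'] by simp
    then show ?thesis
      using False edge_prob_eq_0[OF T \<pi>] edge_prob_eq_0[OF U(1), of "path_code \<pi>"] U(2) mem[OF \<pi>]
      by simp
  qed
  show ?thesis
    using lab edge mem U(2)
    by (auto simp: ptree_prefix_def labelling_rename_ptree[OF g] edge_prob_rename_ptree[OF T g])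
qed

text \<open>Undoing the path coding on the whole unfolding puts \<open>T\<close> below a renamed
  unfolding, and maximality of \<open>T\<close> turns this into equality.\<close>

lemma total_ptree_is_renamed_unfolding:
  assumes T: "T \<in> total_ptrees"
  obtains D h where "is_mc D" "prefix_embedding h (nodes (mc_unfolding D))"
    "T = rename_ptree h (mc_unfolding D)"
proof -
  have tree: "is_ptree T" using T by (simp add: total_ptrees_def)
  have U: "is_ptree (mc_unfolding (mc_of_ptree T))"
    using unfolding_total[of "mc_of_ptree T"] by (simp add: total_ptrees_def)
  obtain h where h: "prefix_embedding h (nodes (mc_unfolding (mc_of_ptree T)))"
    "T \<preceq> rename_ptree h (mc_unfolding (mc_of_ptree T))"
    using rename_ptree_prefixE[OF tree U prefix_embedding_path_code[OF tree]
        rename_path_code_prefix_unfolding[OF tree]] .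
  then show ?thesis
    using that[OF is_mc_mc_of_ptree h(1)] total_ptree_maximal[OF T is_ptree_rename_ptree[OF U h(1)]]
    by blast
qed

section \<open>From counterexamples back to safety and liveness\<close>

lemma only_finite_counterexamples_imp_safety:
  assumes P: "P \<subseteq> total_ptrees" "iso_closed P" and only: "only_finite_counterexamples P"
  shows "safety P"
  unfolding safety_def
proof (intro ballI iffI)
  fix T T1 assume "T \<in> P" "T1 \<in> Pre_fin T"
  then show "\<exists>T2 \<in> P. T1 \<preceq> T2" by (auto simp: Pre_fin_def)
next
  fix T assume T: "T \<in> total_ptrees" and ext: "\<forall>T1 \<in> Pre_fin T. \<exists>T2 \<in> P. T1 \<preceq> T2"
  obtain D h where D: "is_mc D" and h: "prefix_embedding h (nodes (mc_unfolding D))"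
    and T_eq: "T = rename_ptree h (mc_unfolding D)"
    using total_ptree_is_renamed_unfolding[OF T] .
  have U: "is_ptree (mc_unfolding D)" using unfolding_total by (auto simp: total_ptrees_def)
  \<comment> \<open>The assumption speaks about chains, so membership is shown for the unfolding and
    then transported to \<open>T\<close>.\<close>
  have "mc_unfolding D \<in> P"
  proof (rule ccontr)
    assume "mc_unfolding D \<notin> P"
    then obtain T1 where T1: "T1 \<in> finite_depth_ptrees" "T1 \<preceq> mc_unfolding D"
      and bad: "\<forall>T2 \<in> P. \<not> T1 \<preceq> T2"
      using only D by (auto simp: only_finite_counterexamples_def mc_sat_def Pre_fin_def)
    have tree1: "is_ptree T1" using T1 by (simp add: finite_depth_ptrees_def)
    have h1: "prefix_embedding h (nodes T1)"
      using prefix_embedding_subset[OF h] T1(2) by (simp add: ptree_prefix_def)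
    \<comment> \<open>The counterexample is carried over to \<open>T\<close>, extended there into
      \<open>P\<close>, and the extension is carried back.\<close>
    have "rename_ptree h T1 \<in> Pre_fin T"
      using rename_ptree_mono[OF tree1 U T1(2) h] finite_depth_rename_ptree[OF T1(1) h1] T_eq
      by (simp add: Pre_fin_def)
    then obtain T2 where "T2 \<in> P" "rename_ptree h T1 \<preceq> T2" using ext by blast
    then show False using rename_ptree_extends_into[OF P tree1 h1] bad by blast
  qed
  then show "T \<in> P" using iso_closed_rename_ptree[OF P(2) _ U h] T_eq by simp
qed

lemma no_finite_counterexamples_imp_liveness:
  assumes P: "P \<subseteq> total_ptrees" "iso_closed P" and no: "no_finite_counterexamples P"
  shows "liveness P"
  unfolding liveness_def
proof
  fix T1 :: "'a ptree" assume T1: "T1 \<in> finite_depth_ptrees"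
  then have tree1: "is_ptree T1" by (simp add: finite_depth_ptrees_def)
  note g = prefix_embedding_path_code[OF tree1]
  have "rename_ptree path_code T1 \<in> Pre_fin (mc_unfolding (mc_of_ptree T1))"
    using rename_path_code_prefix_unfolding[OF tree1] finite_depth_rename_ptree[OF T1 g]
    by (simp add: Pre_fin_def)
  \<comment> \<open>If the chain satisfies \<open>P\<close>, its unfolding is the required
    extension; otherwise the assumption provides one.\<close>
  then have "\<exists>T2 \<in> P. rename_ptree path_code T1 \<preceq> T2"
    using no is_mc_mc_of_ptree[of T1] rename_path_code_prefix_unfolding[OF tree1]
    unfolding no_finite_counterexamples_def mc_sat_def by blast
  then show "\<exists>T2 \<in> P. T1 \<preceq> T2" using rename_ptree_extends_into[OF P tree1 g] by blast
qed

theorem theorem2: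
  fixes P :: "('ap :: finite) ptree set"
  assumes "P \<subseteq> total_ptrees"
    and "iso_closed P"
  shows "(safety P \<longleftrightarrow> only_finite_counterexamples P) \<and>
         (liveness P \<longleftrightarrow> no_finite_counterexamples P)"
proof (intro conjI iffI)
  \<comment> \<open>Unfoldings are total, so the safety equivalence applies to them
    directly.\<close>
  show "only_finite_counterexamples P" if "safety P"
    using that unfolding_total
    unfolding safety_def only_finite_counterexamples_def mc_sat_def by blast
  show "no_finite_counterexamples P" if "liveness P"
    using that by (auto simp: liveness_def no_finite_counterexamples_def Pre_fin_def)
qed (fact only_finite_counterexamples_imp_safety[OF assms]
       no_finite_counterexamples_imp_liveness[OF assms])+

end
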